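(* Let $f:\mathcal X\to\mathbb R^d$ and $\delta>0$. (1) Let $\mathrm{BM}$ be the Brownian mechanism associated with $f$ and time functions $(T_n)_{n\ge1}$, let $N$ be a stopping function, and let $\psi$ be a $\delta$-privacy boundary for $\mathrm{BM}$. Then $$\sup_{x\sim x'}\mathbb P\left(\mathcal L^{\mathrm{BM}}_{1:N(x)}(x,x')\ge\psi\left(T_{N(x)}(x)\right)\right)\le\delta,$$ i.e. the algorithm $x\mapsto\mathrm{BM}_{1:N(x)}(x)$ is $(\psi(T_{N(\cdot)}(\cdot)),\delta)$-ex-post private. (2) Further, let $(\mathcal E_n)_{n\ge1}$ be a sequence of privacy functions, let $\psi:\mathbb R_{\ge0}\to\mathbb R_{\ge0}$, and define $$T_n(\beta_{1:n-1}):=\inf\{t\ge0:\psi(t)\le\mathcal E_n(\beta_{1:n-1})\}.$$ Suppose that these $(T_n)_{n\ge1}$ are time functions (so that each $T_n$ takes values in $(0,\infty)$), let $\mathrm{BM}$ be the Brownian mechanism associated with $f$ and $(T_n)_{n\ge1}$, suppose $\psi$ is a $\delta$-privacy boundary for $\mathrm{BM}$, and let $N$ be a stopping function. Then $x\mapsto\mathrm{BM}_{1:N(x)}(x)$ is $(\mathcal E_{N(\cdot)}(\cdot),\delta)$-ex-post private, where $\mathcal E_n(x):=\mathcal E_n(\mathrm{BM}_1(x),\dots,\mathrm{BM}_{n-1}(x))$.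
   Context: $\mathcal X$ is a set of databases with an arbitrary neighboring relation $\sim$. Privacy loss: for a randomized algorithm $A$ on $\mathcal X$ with values in a measurable space and $x\sim x'$, let $p^x,p^{x'}$ be the densities of the laws of $A(x),A(x')$ with respect to a common reference measure (e.g. the sum of the two laws). The privacy loss between $A(x)$ and $A(x')$ is the random variable $\mathcal L(x,x')=\log\frac{p^x(A(x))}{p^{x'}(A(x))}$. Ex-post privacy: for a function $\mathcal E$ of the output of $A$ with values in $\mathbb R_{\ge0}$, $A$ is $(\mathcal E,\delta)$-ex-post private if $\mathbb P(\mathcal L(x,x')>\mathcal E(A(x)))\le\delta$ for all $x\sim x'$. Time functions: a sequence of functions $T_n:(\mathbb R^d)^{n-1}\to\mathbb R_{>0}$, $n\ge1$ (so $T_1$ is a constant), with $T_{n+1}(\beta_{1:n})\le T_n(\beta_{1:n-1})$ for all $n\ge1$ and all $\beta_{1:n}=(\beta_1,\dots,\beta_n)\in(\mathbb R^d)^n$. Privacy functions: a sequence of functions $\mathcal E_n:(\mathbb R^d)^{n-1}\to\mathbb R_{\ge0}$, $n\ge1$, with $\mathcal E_{n+1}(\beta_{1:n})\ge\mathcal E_n(\beta_{1:n-1})$ for all $n$ and $\beta_{1:n}\in(\mathbb R^d)^n$. Brownian mechanism: let $(B_t)_{t\ge0}$ be a standard $d$-dimensional Brownian motion started at $0$. $\mathrm{BM}(x)=(\mathrm{BM}_n(x))_{n\ge1}$ with $\mathrm{BM}_n(x)=f(x)+B_{T_n(x)}$, where recursively $T_n(x):=T_n(\mathrm{BM}_1(x),\dots,\mathrm{BM}_{n-1}(x))$.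 Write $\mathrm{BM}_{1:n}(x)=(\mathrm{BM}_1(x),\dots,\mathrm{BM}_n(x))$, and let $\mathcal L^{\mathrm{BM}}_{1:n}(x,x')$ be the privacy loss between $\mathrm{BM}_{1:n}(x)$ and $\mathrm{BM}_{1:n}(x')$. $\delta$-privacy boundary: a function $\psi:\mathbb R_{\ge0}\to\mathbb R_{\ge0}$ is a $\delta$-privacy boundary for $\mathrm{BM}$ (associated with time functions $(T_n)_{n\ge1}$) if for all neighbors $x\sim x'$, $\mathbb P(\exists n\ge1:\mathcal L^{\mathrm{BM}}_{1:n}(x,x')\ge\psi(T_n(x)))\le\delta$. Stopping function: a function $N:(\mathbb R^d)^\infty\to\mathbb N$ such that for every $x\in\mathcal X$, $N(x):=N(\mathrm{BM}(x))$ is a stopping time with respect to the filtration $\mathcal F_n(x)=\sigma(\mathrm{BM}_i(x):i\le n)$, $n\ge1$. $\mathcal L^{\mathrm{BM}}_{1:N(x)}(x,x')$ is the privacy loss between $\mathrm{BM}_{1:N(x)}(x)$ and $\mathrm{BM}_{1:N(x')}(x')$.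
   Formalization: Added, as the claim fails otherwise: (a) for each n, N(x)=n is decided by a Borel set of values of BM_{1:n}(x) that is the same for all databases x; (b) in (2), ψ is lower semicontinuous from the right on (0,∞), so the infimum is attained. T_n, E_n, ψ are taken measurable. *)

theory Defs
  imports "HOL-Probability.Probability"
begin

section \<open>Privacy loss and ex-post privacy\<close>

text \<open>The sum of two measures on the same measurable space; for two laws this is the reference
  measure with respect to which their densities are taken.\<close>

definition sum_of_measures :: "'a measure \<Rightarrow> 'a measure \<Rightarrow> 'a measure" where
  "sum_of_measures P Q = measure_of (space P) (sets P) (\<lambda>A. emeasure P A + emeasure Q A)"

lemma space_sum_of_measures [simp]: "space (sum_of_measures P Q) = space P"
  by (simp add: sum_of_measures_def)

lemma sets_sum_of_measures [simp]: "sets (sum_of_measures P Q) = sets P"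
  by (simp add: sum_of_measures_def)

lemma emeasure_sum_of_measures:
  assumes "sets Q = sets P" "A \<in> sets P"
  shows "emeasure (sum_of_measures P Q) A = emeasure P A + emeasure Q A"
proof (rule emeasure_measure_of[OF sum_of_measures_def])
  show "sets P \<subseteq> Pow (space P)"
    by (rule sets.space_closed)
  show "A \<in> sets (sum_of_measures P Q)"
    using assms by simp
  show "positive (sets (sum_of_measures P Q)) (\<lambda>A. emeasure P A + emeasure Q A)"
    by (simp add: positive_def)
  show "countably_additive (sets (sum_of_measures P Q)) (\<lambda>A. emeasure P A + emeasure Q A)"
    using assms(1)
    by (auto simp: countably_additive_def suminf_emeasure suminf_add[symmetric])
qed

text \<open>The logarithm extended by \<open>log 0 = -\<infinity>\<close> and \<open>log \<infinity> = \<infinity>\<close>, so that the privacy loss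
  is \<open>\<infinity>\<close> where only the second density vanishes.\<close>

definition log_ennreal :: "ennreal \<Rightarrow> ereal" where
  "log_ennreal u = (if u = 0 then -\<infinity> else if u = \<infinity> then \<infinity> else ereal (ln (enn2real u)))"

definition log_density_ratio :: "'a measure \<Rightarrow> 'a measure \<Rightarrow> 'a \<Rightarrow> ereal" where
  "log_density_ratio P Q z =
     log_ennreal (RN_deriv (sum_of_measures P Q) P z / RN_deriv (sum_of_measures P Q) Q z)"

definition privacy_loss ::
  "'w measure \<Rightarrow> 'a measure \<Rightarrow> ('w \<Rightarrow> 'a) \<Rightarrow> ('w \<Rightarrow> 'a) \<Rightarrow> 'w \<Rightarrow> ereal" where
  "privacy_loss M S X X' \<omega> = log_density_ratio (distr M S X) (distr M S X') (X \<omega>)"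

definition ex_post_private ::
  "'w measure \<Rightarrow> 'a measure \<Rightarrow> ('x \<Rightarrow> 'x \<Rightarrow> bool) \<Rightarrow> ('x \<Rightarrow> 'w \<Rightarrow> 'a) \<Rightarrow> ('a \<Rightarrow> real) \<Rightarrow> real \<Rightarrow> bool"
where
  "ex_post_private M S nbr A \<E> \<delta> \<longleftrightarrow>
     (\<forall>x. A x \<in> M \<rightarrow>\<^sub>M S) \<and>
     \<E> \<in> borel_measurable S \<and>
     (\<forall>x. \<forall>\<omega>\<in>space M. 0 \<le> \<E> (A x \<omega>)) \<and>
     (\<forall>x x'. nbr x x' \<longrightarrow>
        measure M {\<omega> \<in> space M. privacy_loss M S (A x) (A x') \<omega> > ereal (\<E> (A x \<omega>))} \<le> \<delta>)"

section \<open>Finite sequences\<close>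

text \<open>Finite sequences \<open>\<beta>\<^sub>1, \<dots>, \<beta>\<^sub>n\<close> are lists, with \<open>\<beta>\<^sub>i\<close> at position \<open>i - 1\<close>. The type of lists
  carries the sigma-algebra of the disjoint union of the product spaces of all lengths \<open>n\<close>: a
  set of lists is measurable iff its part of length \<open>n\<close> is a Borel set of the \<open>n\<close>-fold product,
  for every \<open>n\<close>.\<close>

definition list_sets :: "('a::topological_space) list set set" where
  "list_sets = {A. \<forall>n. {\<beta> \<in> space (Pi\<^sub>M {..<n} (\<lambda>_. borel)). map \<beta> [0..<n] \<in> A}
                      \<in> sets (Pi\<^sub>M {..<n} (\<lambda>_. borel))}"

definition list_borel :: "('a::topological_space) list measure" where
  "list_borel = sigma UNIV list_sets"

lemma space_list_borel [simp]: "space list_borel = UNIV"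
  by (simp add: list_borel_def)

lemma sets_list_borel: "sets list_borel = list_sets"
proof -
  have "sigma_algebra UNIV (list_sets :: 'a list set set)"
    unfolding sigma_algebra_iff2
  proof (intro conjI ballI allI impI)
    show "UNIV - A \<in> list_sets" if "A \<in> list_sets" for A :: "'a list set"
    proof -
      have "{\<beta> \<in> space (Pi\<^sub>M {..<n} (\<lambda>_. borel)). map \<beta> [0..<n] \<in> UNIV - A}
          = space (Pi\<^sub>M {..<n} (\<lambda>_. borel))
            - {\<beta> \<in> space (Pi\<^sub>M {..<n} (\<lambda>_. borel)). map \<beta> [0..<n] \<in> A}" for n
        by auto
      with that show ?thesis
        unfolding list_sets_def by (auto intro!: sets.compl_sets simp del: map_eq_conv)
    qed
    show "(\<Union>i. A i) \<in> list_sets" if "range A \<subseteq> list_sets" for A :: "nat \<Rightarrow> 'a list set"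
    proof -
      have "{\<beta> \<in> space (Pi\<^sub>M {..<n} (\<lambda>_. borel)). map \<beta> [0..<n] \<in> (\<Union>i. A i)}
          = (\<Union>i. {\<beta> \<in> space (Pi\<^sub>M {..<n} (\<lambda>_. borel)). map \<beta> [0..<n] \<in> A i})" for n
        by auto
      with that show ?thesis
        unfolding list_sets_def by (auto intro!: sets.countable_UN simp: subset_iff image_iff)
    qed
  qed (auto simp: list_sets_def)
  then show ?thesis
    by (simp add: list_borel_def sets_measure_of sigma_algebra.sigma_sets_eq)
qed

text \<open>The space of sequences of length \<open>n\<close>.\<close>

definition vec_borel :: "nat \<Rightarrow> ('a::topological_space) list measure" where
  "vec_borel n = restrict_space list_borel {\<beta>. length \<beta> = n}"

section \<open>The Brownian mechanism\<close>

text \<open>The density in the third conjunct is that of \<open>N(0, (t - s) I\<^sub>d)\<close>.\<close>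

definition standard_brownian_motion :: "'w measure \<Rightarrow> (real \<Rightarrow> 'w \<Rightarrow> real ^ 'd) \<Rightarrow> bool" where
  "standard_brownian_motion M B \<longleftrightarrow>
     prob_space M \<and>
     (\<forall>t\<ge>0. B t \<in> borel_measurable M) \<and>
     (\<forall>s t. 0 \<le> s \<longrightarrow> s < t \<longrightarrow>
        distributed M lborel (\<lambda>\<omega>. B t \<omega> - B s \<omega>)
          (\<lambda>v. ennreal (\<Prod>i\<in>UNIV. normal_density 0 (sqrt (t - s)) (v $ i)))) \<and>
     (\<forall>(n::nat) (t::nat \<Rightarrow> real). 0 \<le> t 0 \<longrightarrow> (\<forall>i<n. t i < t (Suc i)) \<longrightarrow>
        prob_space.indep_vars M (\<lambda>_. borel) (\<lambda>i \<omega>. B (t (Suc i)) \<omega> - B (t i) \<omega>) {..<n}) \<and>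
     (\<forall>\<omega>\<in>space M. B 0 \<omega> = 0) \<and>
     (\<forall>\<omega>\<in>space M. continuous_on {0..} (\<lambda>t. B t \<omega>))"

text \<open>A sequence of functions \<open>g\<^sub>n\<close> of \<open>\<beta>\<^sub>1, \<dots>, \<beta>\<^sub>n\<^sub>-\<^sub>1\<close>, \<open>n \<ge> 1\<close>, is a function of the index \<open>n\<close>
  and a list; only its values at \<open>n \<ge> 1\<close> and lists of length \<open>n - 1\<close> matter. For a list of
  length \<open>n\<close>, \<open>butlast\<close> drops \<open>\<beta>\<^sub>n\<close>. Measurability is needed for the outputs of the mechanism to be
  random variables and for the events below to have a probability.\<close>

definition time_functions :: "(nat \<Rightarrow> (real ^ 'd) list \<Rightarrow> real) \<Rightarrow> bool" where
  "time_functions T \<longleftrightarrow>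
     (\<forall>n\<ge>1. T n \<in> borel_measurable (vec_borel (n - 1))) \<and>
     (\<forall>n\<ge>1. \<forall>\<beta>. length \<beta> = n - 1 \<longrightarrow> 0 < T n \<beta>) \<and>
     (\<forall>n\<ge>1. \<forall>\<beta>. length \<beta> = n \<longrightarrow> T (n + 1) \<beta> \<le> T n (butlast \<beta>))"

definition privacy_functions :: "(nat \<Rightarrow> (real ^ 'd) list \<Rightarrow> real) \<Rightarrow> bool" where
  "privacy_functions \<E> \<longleftrightarrow>
     (\<forall>n\<ge>1. \<E> n \<in> borel_measurable (vec_borel (n - 1))) \<and>
     (\<forall>n\<ge>1. \<forall>\<beta>. length \<beta> = n - 1 \<longrightarrow> 0 \<le> \<E> n \<beta>) \<and>
     (\<forall>n\<ge>1. \<forall>\<beta>. length \<beta> = n \<longrightarrow> \<E> (n + 1) \<beta> \<ge> \<E> n (butlast \<beta>))"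

text \<open>\<open>bm_upto f T B x n\<close> is \<open>(BM\<^sub>1(x), \<dots>, BM\<^sub>n(x))\<close>.\<close>

primrec bm_upto ::
  "('x \<Rightarrow> real ^ 'd) \<Rightarrow> (nat \<Rightarrow> (real ^ 'd) list \<Rightarrow> real) \<Rightarrow> (real \<Rightarrow> 'w \<Rightarrow> real ^ 'd) \<Rightarrow>
   'x \<Rightarrow> nat \<Rightarrow> 'w \<Rightarrow> (real ^ 'd) list" where
  "bm_upto f T B x 0 \<omega> = []"
| "bm_upto f T B x (Suc n) \<omega> =
     bm_upto f T B x n \<omega> @ [f x + B (T (Suc n) (bm_upto f T B x n \<omega>)) \<omega>]"

definition bm_time ::
  "('x \<Rightarrow> real ^ 'd) \<Rightarrow> (nat \<Rightarrow> (real ^ 'd) list \<Rightarrow> real) \<Rightarrow> (real \<Rightarrow> 'w \<Rightarrow> real ^ 'd) \<Rightarrow>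
   'x \<Rightarrow> nat \<Rightarrow> 'w \<Rightarrow> real" where
  "bm_time f T B x n \<omega> = T n (bm_upto f T B x (n - 1) \<omega>)"

definition bm ::
  "('x \<Rightarrow> real ^ 'd) \<Rightarrow> (nat \<Rightarrow> (real ^ 'd) list \<Rightarrow> real) \<Rightarrow> (real \<Rightarrow> 'w \<Rightarrow> real ^ 'd) \<Rightarrow>
   'x \<Rightarrow> nat \<Rightarrow> 'w \<Rightarrow> real ^ 'd" where
  "bm f T B x n \<omega> = f x + B (bm_time f T B x n \<omega>) \<omega>"

lemma bm_upto_eq_map: "bm_upto f T B x n \<omega> = map (\<lambda>i. bm f T B x i \<omega>) [1..<Suc n]"
  by (induction n) (simp_all add: bm_def bm_time_def)

text \<open>The privacy loss between \<open>BM\<^sub>1\<^sub>:\<^sub>n(x)\<close> and \<open>BM\<^sub>1\<^sub>:\<^sub>n(x')\<close>.\<close>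

definition bm_loss ::
  "'w measure \<Rightarrow> ('x \<Rightarrow> real ^ 'd) \<Rightarrow> (nat \<Rightarrow> (real ^ 'd) list \<Rightarrow> real) \<Rightarrow>
   (real \<Rightarrow> 'w \<Rightarrow> real ^ 'd) \<Rightarrow> 'x \<Rightarrow> 'x \<Rightarrow> nat \<Rightarrow> 'w \<Rightarrow> ereal" where
  "bm_loss M f T B x x' n =
     privacy_loss M (vec_borel n) (bm_upto f T B x n) (bm_upto f T B x' n)"

definition privacy_boundary ::
  "'w measure \<Rightarrow> ('x \<Rightarrow> 'x \<Rightarrow> bool) \<Rightarrow> ('x \<Rightarrow> real ^ 'd) \<Rightarrow>
   (nat \<Rightarrow> (real ^ 'd) list \<Rightarrow> real) \<Rightarrow> (real \<Rightarrow> 'w \<Rightarrow> real ^ 'd) \<Rightarrow> real \<Rightarrow> (real \<Rightarrow> real) \<Rightarrow> bool"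
where
  "privacy_boundary M nbr f T B \<delta> \<psi> \<longleftrightarrow>
     \<psi> \<in> borel_measurable (restrict_space borel {0..}) \<and>
     (\<forall>t\<ge>0. 0 \<le> \<psi> t) \<and>
     (\<forall>x x'. nbr x x' \<longrightarrow>
        measure M {\<omega> \<in> space M. \<exists>n\<ge>1. bm_loss M f T B x x' n \<omega> \<ge> ereal (\<psi> (bm_time f T B x n \<omega>))}
          \<le> \<delta>)"

section \<open>Stopping functions\<close>

text \<open>The infinite sequence \<open>(BM\<^sub>n(x))\<^sub>n\<^sub>\<ge>\<^sub>1\<close>, with \<open>BM\<^sub>n(x)\<close> at position \<open>n - 1\<close>.\<close>

definition bm_path ::
  "('x \<Rightarrow> real ^ 'd) \<Rightarrow> (nat \<Rightarrow> (real ^ 'd) list \<Rightarrow> real) \<Rightarrow> (real \<Rightarrow> 'w \<Rightarrow> real ^ 'd) \<Rightarrow>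
   'x \<Rightarrow> 'w \<Rightarrow> (nat \<Rightarrow> real ^ 'd)" where
  "bm_path f T B x \<omega> = (\<lambda>i. bm f T B x (Suc i) \<omega>)"

definition bm_filtration ::
  "'w measure \<Rightarrow> ('x \<Rightarrow> real ^ 'd) \<Rightarrow> (nat \<Rightarrow> (real ^ 'd) list \<Rightarrow> real) \<Rightarrow>
   (real \<Rightarrow> 'w \<Rightarrow> real ^ 'd) \<Rightarrow> 'x \<Rightarrow> nat \<Rightarrow> 'w measure" where
  "bm_filtration M f T B x n =
     sigma (space M) {bm f T B x i -` A \<inter> space M | i A. 1 \<le> i \<and> i \<le> n \<and> A \<in> sets borel}"

text \<open>The last conjunct makes explicit that a stopping rule sees the released outputs only: whether
  to stop after the \<open>n\<close>-th output is decided by a Borel set \<open>C\<close> of sequences which does not depend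
  on the database. The second conjunct alone yields such a set for each \<open>x\<close> separately, which is
  too weak: if \<open>T\<^sub>n = 1/n\<close>, then \<open>BM\<^sub>n(x)\<close> converges to \<open>f x\<close>, and the rule that stops after one
  step if \<open>lim \<beta>\<^sub>n = f x\<^sub>0\<close> and after two steps otherwise gives a constant \<open>N(x)\<close> for every \<open>x\<close>,
  although its value reveals whether \<open>f x = f x\<^sub>0\<close>. The value of \<open>N\<close> is at least \<open>1\<close> because the
  outputs are numbered from \<open>1\<close>.\<close>

definition stopping_function ::
  "'w measure \<Rightarrow> ('x \<Rightarrow> real ^ 'd) \<Rightarrow> (nat \<Rightarrow> (real ^ 'd) list \<Rightarrow> real) \<Rightarrow>
   (real \<Rightarrow> 'w \<Rightarrow> real ^ 'd) \<Rightarrow> ((nat \<Rightarrow> real ^ 'd) \<Rightarrow> nat) \<Rightarrow> bool" where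
  "stopping_function M f T B N \<longleftrightarrow>
     (\<forall>\<beta>. 1 \<le> N \<beta>) \<and>
     (\<forall>x. stopping_time (bm_filtration M f T B x) (\<lambda>\<omega>. N (bm_path f T B x \<omega>))) \<and>
     (\<forall>n\<ge>1. \<exists>C\<in>sets (vec_borel n). \<forall>x. \<forall>\<omega>\<in>space M.
        N (bm_path f T B x \<omega>) = n \<longleftrightarrow> bm_upto f T B x n \<omega> \<in> C)"

text \<open>\<open>BM\<^sub>1\<^sub>:\<^sub>N(x)\<close>, with \<open>N\<close> evaluated at \<open>BM(x)\<close>.\<close>

definition bm_stopped ::
  "('x \<Rightarrow> real ^ 'd) \<Rightarrow> (nat \<Rightarrow> (real ^ 'd) list \<Rightarrow> real) \<Rightarrow> (real \<Rightarrow> 'w \<Rightarrow> real ^ 'd) \<Rightarrow>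
   ((nat \<Rightarrow> real ^ 'd) \<Rightarrow> nat) \<Rightarrow> 'x \<Rightarrow> 'w \<Rightarrow> (real ^ 'd) list" where
  "bm_stopped f T B N x \<omega> = bm_upto f T B x (N (bm_path f T B x \<omega>)) \<omega>"

text \<open>Lower semicontinuity from the right on \<open>(0, \<infinity>)\<close>; implied by (right-)continuity. It makes the
  infimum of \<open>{t \<ge> 0. \<psi> t \<le> e}\<close>, if positive and finite, belong to this set.\<close>

definition right_lower_semicontinuous :: "(real \<Rightarrow> real) \<Rightarrow> bool" where
  "right_lower_semicontinuous \<psi> \<longleftrightarrow>
     (\<forall>t>0. \<forall>c<\<psi> t. eventually (\<lambda>s. c < \<psi> s) (at_right t))"

end

theory Submission
  imports Defs
begin

text \<open>Whether the mechanism stops after \<open>n\<close> outputs is decided by a set \<open>C\<close> of sequences of length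
  \<open>n\<close> that does not depend on the database. On \<open>C\<close> the laws of the stopped outputs and of the first
  \<open>n\<close> outputs coincide, for both databases, hence so do the density ratios almost everywhere. The
  privacy loss at the stopping time is therefore almost surely the loss \<open>\<L>\<^bsub>1:n\<^esub>\<close> at \<open>n = N(x)\<close>, and the
  boundary, which holds for all \<open>n\<close> simultaneously, applies. For the second part, semicontinuity
  gives \<open>\<psi>(T\<^sub>n) \<le> \<E>\<^sub>n\<close>.\<close>

section \<open>Measurability of finite sequences\<close>

lemma length_in_list_borel: "{\<beta> :: 'a::topological_space list. length \<beta> = n} \<in> sets list_borel"
  by (simp add: sets_list_borel list_sets_def)

lemma space_vec_borel [simp]:
  "space (vec_borel n) = {\<beta> :: 'a::topological_space list. length \<beta> = n}"
  by (simp add: vec_borel_def space_restrict_space)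

lemma sets_vec_borel_iff:
  "A \<in> sets (vec_borel n) \<longleftrightarrow>
     A \<subseteq> {\<beta> :: 'a::topological_space list. length \<beta> = n} \<and> A \<in> sets list_borel"
  unfolding vec_borel_def by (subst sets_restrict_space_iff) (auto simp: length_in_list_borel)

text \<open>A measurable set of lists is defined through its coordinates in the product space, so
  \<open>X\<close> is factored through the product-valued map \<open>?g\<close>, which is measurable
  coordinate by coordinate.\<close>

lemma measurable_vec_borelI:
  fixes X :: "'w \<Rightarrow> 'a::topological_space list"
  assumes len: "\<And>\<omega>. \<omega> \<in> space M \<Longrightarrow> length (X \<omega>) = n"
    and nth: "\<And>i. i < n \<Longrightarrow> (\<lambda>\<omega>. X \<omega> ! i) \<in> borel_measurable M"
  shows "X \<in> M \<rightarrow>\<^sub>M vec_borel n"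
proof (rule measurableI)
  fix A :: "'a list set" assume "A \<in> sets (vec_borel n)"
  then have A: "A \<in> list_sets"
    by (simp add: sets_vec_borel_iff sets_list_borel)
  let ?g = "\<lambda>\<omega>. \<lambda>i\<in>{..<n}. X \<omega> ! i"
  have g: "?g \<in> M \<rightarrow>\<^sub>M Pi\<^sub>M {..<n} (\<lambda>_. borel)"
    by (rule measurable_restrict) (simp add: nth)
  have "map (?g \<omega>) [0..<n] = X \<omega>" if "\<omega> \<in> space M" for \<omega>
    using len[OF that] by (intro nth_equalityI) auto
  then have "X -` A \<inter> space M
      = ?g -` {\<beta> \<in> space (Pi\<^sub>M {..<n} (\<lambda>_. borel)). map \<beta> [0..<n] \<in> A} \<inter> space M"
    using measurable_space[OF g] by (auto simp del: map_eq_conv)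
  also have "\<dots> \<in> sets M"
    using A by (intro measurable_sets[OF g]) (auto simp: list_sets_def)
  finally show "X -` A \<inter> space M \<in> sets M" .
qed (simp add: len)

lemma measurable_nth_vec_borel:
  assumes "i < n"
  shows "(\<lambda>\<beta> :: 'a::topological_space list. \<beta> ! i) \<in> borel_measurable (vec_borel n)"
proof (rule measurableI)
  fix S :: "'a set" assume S: "S \<in> sets borel"
  \<comment> \<open>Membership in \<open>list_sets\<close> has to be checked at every length
    \<open>m\<close>. The length constraint leaves only \<open>m = n\<close>, where the slice is a
    cylinder over coordinate \<open>i\<close>.\<close>
  have "{\<beta> \<in> space (Pi\<^sub>M {..<m} (\<lambda>_. borel)).
           map \<beta> [0..<m] \<in> (\<lambda>\<beta>. \<beta> ! i) -` S \<inter> {\<beta>. length \<beta> = n}}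
      = (if m = n then (\<lambda>\<beta>. \<beta> i) -` S \<inter> space (Pi\<^sub>M {..<m} (\<lambda>_. borel)) else {})" for m
    using assms by auto
  moreover have "(\<lambda>\<beta>. \<beta> i) -` S \<inter> space (Pi\<^sub>M {..<n} (\<lambda>_. borel)) \<in> sets (Pi\<^sub>M {..<n} (\<lambda>_. borel))"
    using assms S by (intro measurable_sets[OF measurable_component_singleton]) auto
  ultimately show "(\<lambda>\<beta>. \<beta> ! i) -` S \<inter> space (vec_borel n) \<in> sets (vec_borel n)"
    by (simp add: sets_vec_borel_iff sets_list_borel list_sets_def)
qed simp

lemma measurable_butlast_vec_borel:
  "(butlast :: 'a::topological_space list \<Rightarrow> 'a list) \<in> vec_borel n \<rightarrow>\<^sub>M vec_borel (n - 1)"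
proof (rule measurable_vec_borelI)
  fix i assume i: "i < n - 1"
  then have "(\<lambda>\<beta> :: 'a list. \<beta> ! i) \<in> borel_measurable (vec_borel n)"
    by (intro measurable_nth_vec_borel) simp
  then show "(\<lambda>\<beta> :: 'a list. butlast \<beta> ! i) \<in> borel_measurable (vec_borel n)"
    by (rule measurable_cong[THEN iffD1, rotated]) (use i in \<open>simp add: nth_butlast\<close>)
qed simp

lemma measurable_vec_borel_list_borel:
  "X \<in> M \<rightarrow>\<^sub>M vec_borel n \<Longrightarrow> X \<in> M \<rightarrow>\<^sub>M list_borel"
  unfolding vec_borel_def by (simp add: measurable_restrict_space2_iff)

text \<open>The length classes form a countable measurable partition of the space of lists, so
  measurability can be tested on each of them.\<close>

lemma measurable_list_borelI:
  fixes g :: "'a::topological_space list \<Rightarrow> 'b"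
  assumes "\<And>n. g \<in> vec_borel n \<rightarrow>\<^sub>M S"
  shows "g \<in> list_borel \<rightarrow>\<^sub>M S"
proof (rule measurable_piecewise_restrict)
  show "countable (range (\<lambda>n. {\<beta> :: 'a list. length \<beta> = n}))"
    by simp
qed (use assms in \<open>auto simp: length_in_list_borel vec_borel_def\<close>)

lemma measurable_vec_borel_0:
  fixes g :: "'a::topological_space list \<Rightarrow> real"
  shows "g \<in> borel_measurable (vec_borel 0)"
proof -
  have "(\<lambda>_ :: 'a list. g []) \<in> borel_measurable (vec_borel 0)"
    by simp
  then show ?thesis
    by (rule measurable_cong[THEN iffD1, rotated]) simp
qed

text \<open>Turns a sequence of privacy functions into one function of the released list, as
  \<open>ex_post_private\<close> demands: the length recovers the index and \<open>butlast\<close>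
  the arguments.\<close>

lemma measurable_length_butlast:
  fixes g :: "nat \<Rightarrow> 'a::topological_space list \<Rightarrow> real"
  assumes "\<And>n. n \<ge> 1 \<Longrightarrow> g n \<in> borel_measurable (vec_borel (n - 1))"
  shows "(\<lambda>\<beta>. g (length \<beta>) (butlast \<beta>)) \<in> borel_measurable list_borel"
proof (rule measurable_list_borelI)
  fix n
  show "(\<lambda>\<beta>. g (length \<beta>) (butlast \<beta>)) \<in> borel_measurable (vec_borel n)"
  proof (cases "n = 0")
    \<comment> \<open>The assumption starts at index 1. At length 0 the space is the single point
      \<open>[]\<close>, on which every function is constant.\<close>
    case True
    then show ?thesis by (simp add: measurable_vec_borel_0)
  next
    case False
    then have "(\<lambda>\<beta>. g n (butlast \<beta>)) \<in> borel_measurable (vec_borel n)"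
      using measurable_compose[OF measurable_butlast_vec_borel assms, of n] by simp
    then show ?thesis
      by (rule measurable_cong[THEN iffD1, rotated]) simp
  qed
qed

section \<open>Density ratios\<close>

lemma finite_measure_sum_of_measures:
  assumes "finite_measure P" "finite_measure Q" "sets Q = sets P"
  shows "finite_measure (sum_of_measures P Q)"
proof
  have "space Q = space P"
    using assms(3) by (rule sets_eq_imp_space_eq)
  then show "emeasure (sum_of_measures P Q) (space (sum_of_measures P Q)) \<noteq> \<infinity>"
    using finite_measure.emeasure_finite[OF assms(1)] finite_measure.emeasure_finite[OF assms(2)]
    by (simp add: emeasure_sum_of_measures[OF assms(3)])
qed

text \<open>In \<open>ennreal\<close> a sum vanishes only if both summands do.\<close>

lemma absolutely_continuous_sum_of_measures:
  assumes "sets Q = sets P"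
  shows "absolutely_continuous (sum_of_measures P Q) P"
    and "absolutely_continuous (sum_of_measures P Q) Q"
  using assms by (auto simp: absolutely_continuous_def null_sets_def emeasure_sum_of_measures)

text \<open>Localization of densities. The measures \<open>\<mu>\<close> and \<open>\<mu>'\<close>
  may carry different sigma-algebras, but they restrict to one and the same measure on
  \<open>C\<close>. Over it both derivatives are densities of the same measure, and densities over a
  sigma-finite measure are unique almost everywhere.\<close>

lemma RN_deriv_eq_on:
  assumes \<mu>: "finite_measure \<mu>" and \<mu>': "finite_measure \<mu>'"
    and ac: "absolutely_continuous \<mu> P" and ac': "absolutely_continuous \<mu>' P'"
    and sets_P: "sets P = sets \<mu>" and sets_P': "sets P' = sets \<mu>'"
    and C: "C \<in> sets \<mu>" "C \<in> sets \<mu>'"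
    and sets_iff: "\<And>A. A \<subseteq> C \<Longrightarrow> A \<in> sets \<mu> \<longleftrightarrow> A \<in> sets \<mu>'"
    and \<mu>_eq: "\<And>A. A \<subseteq> C \<Longrightarrow> A \<in> sets \<mu> \<Longrightarrow> emeasure \<mu> A = emeasure \<mu>' A"
    and P_eq: "\<And>A. A \<subseteq> C \<Longrightarrow> A \<in> sets \<mu> \<Longrightarrow> emeasure P A = emeasure P' A"
  shows "AE z in \<mu>. z \<in> C \<longrightarrow> RN_deriv \<mu> P z = RN_deriv \<mu>' P' z"
proof -
  interpret \<mu>: finite_measure \<mu> by fact
  interpret \<mu>': finite_measure \<mu>' by fact
  let ?R = "restrict_space \<mu> C"
  have C_sp: "C \<inter> space \<mu> \<in> sets \<mu>" "C \<inter> space \<mu>' \<in> sets \<mu>'"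
    using C by auto
  have R_eq: "?R = restrict_space \<mu>' C"
  proof (rule measure_eqI)
    show "sets ?R = sets (restrict_space \<mu>' C)"
      using sets_iff by (auto simp: sets_restrict_space_iff[OF C_sp(1)] sets_restrict_space_iff[OF C_sp(2)])
    fix A assume "A \<in> sets ?R"
    then show "emeasure ?R A = emeasure (restrict_space \<mu>' C) A"
      using \<mu>_eq C_sp
      by (simp add: emeasure_restrict_space sets_restrict_space_iff)
  qed
  have R: "finite_measure ?R"
    using C_sp(1) \<mu>.emeasure_finite
    by (intro finite_measureI) (simp add: emeasure_restrict_space space_restrict_space)
  \<comment> \<open>The second derivative is measurable on the restriction of \<open>\<mu>'\<close>;
    \<open>R_eq\<close> identifies that space with \<open>?R\<close>.\<close>
  have meas: "RN_deriv \<mu> P \<in> borel_measurable ?R" "RN_deriv \<mu>' P' \<in> borel_measurable ?R"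
    by (simp_all add: measurable_restrict_space1) (simp add: R_eq measurable_restrict_space1)
  \<comment> \<open>Stated for a generic pair, so that it applies to both \<open>(\<mu>, P)\<close>
    and \<open>(\<mu>', P')\<close>. Since \<open>A\<close> lies in \<open>C\<close>, the indicator
    of \<open>C\<close> that the restriction adds is absorbed.\<close>
  have dens: "emeasure (density (restrict_space \<nu> C) (RN_deriv \<nu> K)) A = emeasure K A"
    if \<nu>: "finite_measure \<nu>" and K: "absolutely_continuous \<nu> K" "sets K = sets \<nu>"
      and C\<nu>: "C \<in> sets \<nu>" and A: "A \<subseteq> C" "A \<in> sets \<nu>" for \<nu> K :: "'a measure" and A
  proof -
    interpret \<nu>: finite_measure \<nu> by fact
    have C\<nu>': "C \<inter> space \<nu> \<in> sets \<nu>"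
      using C\<nu> by auto
    have "emeasure (density (restrict_space \<nu> C) (RN_deriv \<nu> K)) A
        = (\<integral>\<^sup>+z. RN_deriv \<nu> K z * indicator A z * indicator C z \<partial>\<nu>)"
      using A C\<nu>' by (simp add: emeasure_density sets_restrict_space_iff measurable_restrict_space1
          nn_integral_restrict_space)
    also have "\<dots> = (\<integral>\<^sup>+z. RN_deriv \<nu> K z * indicator A z \<partial>\<nu>)"
      using A(1) by (intro nn_integral_cong) (auto simp: indicator_def)
    also have "\<dots> = emeasure (density \<nu> (RN_deriv \<nu> K)) A"
      using A by (simp add: emeasure_density)
    also have "\<dots> = emeasure K A"
      using \<nu>.density_RN_deriv[OF K] by simp
    finally show ?thesis .
  qed
  have "density ?R (RN_deriv \<mu> P) = density ?R (RN_deriv \<mu>' P')"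
  proof (rule measure_eqI)
    fix A assume "A \<in> sets (density ?R (RN_deriv \<mu> P))"
    then have A: "A \<subseteq> C" "A \<in> sets \<mu>"
      using C_sp by (auto simp: sets_restrict_space_iff)
    have "emeasure (density ?R (RN_deriv \<mu> P)) A = emeasure P A"
      using \<mu> ac sets_P C(1) A by (rule dens)
    also have "\<dots> = emeasure P' A"
      using A by (rule P_eq)
    also have "\<dots> = emeasure (density (restrict_space \<mu>' C) (RN_deriv \<mu>' P')) A"
      using \<mu>' ac' sets_P' C(2) A(1) sets_iff[OF A(1), THEN iffD1, OF A(2)] by (rule dens[symmetric])
    finally show "emeasure (density ?R (RN_deriv \<mu> P)) A = emeasure (density ?R (RN_deriv \<mu>' P')) A"
      by (simp add: R_eq)
  qed simp
  then have "AE z in ?R. RN_deriv \<mu> P z = RN_deriv \<mu>' P' z"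
    using sigma_finite_measure.density_unique_iff[OF finite_measure.sigma_finite_measure[OF R] meas] by simp
  then show ?thesis
    using AE_restrict_space_iff[OF C_sp(1)] by simp
qed

text \<open>The reference measures are sums, so they agree below \<open>C\<close> as soon as their
  summands do, and \<open>RN_deriv_eq_on\<close> applies to numerator and denominator. The
  exceptional set is null for the sum \<open>?\<mu>\<close>, hence for \<open>P\<close>, which is
  absolutely continuous with respect to it.\<close>

lemma log_density_ratio_eq_on:
  assumes fin: "finite_measure P" "finite_measure Q" "finite_measure P'" "finite_measure Q'"
    and sets_Q: "sets Q = sets P" and sets_Q': "sets Q' = sets P'"
    and C: "C \<in> sets P" "C \<in> sets P'"
    and sets_iff: "\<And>A. A \<subseteq> C \<Longrightarrow> A \<in> sets P \<longleftrightarrow> A \<in> sets P'"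
    and P_eq: "\<And>A. A \<subseteq> C \<Longrightarrow> A \<in> sets P \<Longrightarrow> emeasure P A = emeasure P' A"
    and Q_eq: "\<And>A. A \<subseteq> C \<Longrightarrow> A \<in> sets P \<Longrightarrow> emeasure Q A = emeasure Q' A"
  shows "AE z in P. z \<in> C \<longrightarrow> log_density_ratio P Q z = log_density_ratio P' Q' z"
proof -
  let ?\<mu> = "sum_of_measures P Q" and ?\<mu>' = "sum_of_measures P' Q'"
  have \<mu>: "finite_measure ?\<mu>" and \<mu>': "finite_measure ?\<mu>'"
    using fin sets_Q sets_Q' by (auto intro: finite_measure_sum_of_measures)
  have \<mu>_eq: "emeasure ?\<mu> A = emeasure ?\<mu>' A" if "A \<subseteq> C" "A \<in> sets P" for A
    using that sets_iff[OF that(1)] P_eq[OF that] Q_eq[OF that]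
    by (simp add: emeasure_sum_of_measures sets_Q sets_Q')
  have "AE z in ?\<mu>. z \<in> C \<longrightarrow> RN_deriv ?\<mu> P z = RN_deriv ?\<mu>' P' z"
    using C sets_iff P_eq \<mu>_eq sets_Q sets_Q'
    by (intro RN_deriv_eq_on \<mu> \<mu>' absolutely_continuous_sum_of_measures) auto
  moreover have "AE z in ?\<mu>. z \<in> C \<longrightarrow> RN_deriv ?\<mu> Q z = RN_deriv ?\<mu>' Q' z"
    using C sets_iff Q_eq \<mu>_eq sets_Q sets_Q'
    by (intro RN_deriv_eq_on \<mu> \<mu>' absolutely_continuous_sum_of_measures) auto
  ultimately have "AE z in ?\<mu>. z \<in> C \<longrightarrow> log_density_ratio P Q z = log_density_ratio P' Q' z"
    by eventually_elim (simp add: log_density_ratio_def)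
  then show ?thesis
    by (rule absolutely_continuous_AE[OF sets_sum_of_measures[symmetric]
          absolutely_continuous_sum_of_measures(1)[OF sets_Q]])
qed

lemma measurable_log_ennreal [measurable]: "log_ennreal \<in> borel_measurable borel"
  unfolding log_ennreal_def by measurable

lemma measurable_log_density_ratio:
  assumes "sets P = sets S"
  shows "log_density_ratio P Q \<in> borel_measurable S"
proof -
  have "log_density_ratio P Q \<in> borel_measurable (sum_of_measures P Q)"
    unfolding log_density_ratio_def by measurable
  then show ?thesis
    using assms by (simp cong: measurable_cong_sets)
qed

lemma measurable_privacy_loss:
  assumes "X \<in> M \<rightarrow>\<^sub>M S"
  shows "privacy_loss M S X X' \<in> borel_measurable M"
  unfolding privacy_loss_def by (rule measurable_compose[OF assms measurable_log_density_ratio]) simp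

section \<open>The Brownian mechanism\<close>

text \<open>Rounding \<open>\<tau>\<close> down to a multiple of \<open>1 / Suc k\<close> gives a
  time with countably many values, at which the process is measurable. Path continuity yields the
  claim as a pointwise limit.\<close>

lemma measurable_process_at_random_time:
  fixes X :: "real \<Rightarrow> 'w \<Rightarrow> 'b::metric_space"
  assumes X: "\<And>t. t \<ge> 0 \<Longrightarrow> X t \<in> borel_measurable M"
    and cont: "\<And>\<omega>. \<omega> \<in> space M \<Longrightarrow> continuous_on {0..} (\<lambda>t. X t \<omega>)"
    and \<tau> [measurable]: "\<tau> \<in> borel_measurable M"
    and pos: "\<And>\<omega>. \<omega> \<in> space M \<Longrightarrow> 0 \<le> \<tau> \<omega>"
  shows "(\<lambda>\<omega>. X (\<tau> \<omega>) \<omega>) \<in> borel_measurable M"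
proof (rule borel_measurable_LIMSEQ_metric)
  let ?j = "\<lambda>k \<omega>. nat \<lfloor>real (Suc k) * \<tau> \<omega>\<rfloor>"
  let ?\<tau> = "\<lambda>k \<omega>. real (?j k \<omega>) / real (Suc k)"
  show "(\<lambda>\<omega>. X (?\<tau> k \<omega>) \<omega>) \<in> borel_measurable M" for k
  proof (rule measurable_compose_countable[where g = "?j k" and f = "\<lambda>j. X (real j / real (Suc k))"])
    show "?j k \<in> M \<rightarrow>\<^sub>M count_space UNIV"
      by measurable
  qed (simp add: X)
  fix \<omega> assume \<omega>: "\<omega> \<in> space M"
  have "(\<lambda>k. ?\<tau> k \<omega>) \<longlonglongrightarrow> \<tau> \<omega>"
  proof (rule real_tendsto_sandwich)
    \<comment> \<open>Since \<open>\<tau>\<close> is nonnegative, \<open>nat\<close> does not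
      truncate the floor.\<close>
    have eq: "real (?j k \<omega>) = of_int \<lfloor>real (Suc k) * \<tau> \<omega>\<rfloor>" for k
      using pos[OF \<omega>] by (subst of_nat_nat) (simp_all del: of_nat_Suc)
    show "\<forall>\<^sub>F k in sequentially. \<tau> \<omega> - 1 / real (Suc k) \<le> ?\<tau> k \<omega>"
    proof (rule always_eventually, rule allI)
      fix k
      have "real (Suc k) * \<tau> \<omega> - 1 \<le> real (?j k \<omega>)"
        unfolding eq by linarith
      then have "(real (Suc k) * \<tau> \<omega> - 1) / real (Suc k) \<le> ?\<tau> k \<omega>"
        by (rule divide_right_mono) simp
      then show "\<tau> \<omega> - 1 / real (Suc k) \<le> ?\<tau> k \<omega>"
        by (simp add: diff_divide_distrib del: of_nat_Suc)
    qed
    show "\<forall>\<^sub>F k in sequentially. ?\<tau> k \<omega> \<le> \<tau> \<omega>"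
    proof (rule always_eventually, rule allI)
      fix k
      have "real (?j k \<omega>) \<le> real (Suc k) * \<tau> \<omega>"
        unfolding eq by linarith
      then show "?\<tau> k \<omega> \<le> \<tau> \<omega>"
        by (simp add: field_simps del: of_nat_Suc)
    qed
    show "(\<lambda>k. \<tau> \<omega> - 1 / real (Suc k)) \<longlonglongrightarrow> \<tau> \<omega>"
      using tendsto_diff[OF tendsto_const LIMSEQ_inverse_real_of_nat, of "\<tau> \<omega>"]
      by (simp add: inverse_eq_divide)
  qed simp
  then show "(\<lambda>k. X (?\<tau> k \<omega>) \<omega>) \<longlonglongrightarrow> X (\<tau> \<omega>) \<omega>"
    using pos[OF \<omega>] by (intro continuous_on_tendsto_compose[OF cont[OF \<omega>]]) auto
qed

lemma length_bm_upto [simp]: "length (bm_upto f T B x n \<omega>) = n"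
  by (simp add: bm_upto_eq_map)

text \<open>Induction on the number of outputs: the next time is a measurable function of the
  earlier outputs, hence a random time at which the Brownian motion may be evaluated.\<close>

lemma measurable_bm_upto:
  fixes B :: "real \<Rightarrow> 'w \<Rightarrow> real ^ 'd"
  assumes B: "standard_brownian_motion M B" and T: "time_functions T"
  shows "bm_upto f T B x n \<in> M \<rightarrow>\<^sub>M vec_borel n"
proof (induction n)
  case 0
  show ?case
    by (rule measurable_vec_borelI) simp_all
next
  case (Suc n)
  have "T (Suc n) \<in> borel_measurable (vec_borel n)"
    using T unfolding time_functions_def by (metis One_nat_def diff_Suc_1 le_add1 plus_1_eq_Suc)
  then have "(\<lambda>\<omega>. T (Suc n) (bm_upto f T B x n \<omega>)) \<in> borel_measurable M"
    by (rule measurable_compose[OF Suc])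
  moreover have "0 \<le> T (Suc n) (bm_upto f T B x n \<omega>)" for \<omega>
    using T unfolding time_functions_def by (intro less_imp_le) simp
  moreover have "\<And>t. t \<ge> 0 \<Longrightarrow> B t \<in> borel_measurable M"
    and "\<And>\<omega>. \<omega> \<in> space M \<Longrightarrow> continuous_on {0..} (\<lambda>t. B t \<omega>)"
    using B by (simp_all add: standard_brownian_motion_def)
  ultimately have last: "(\<lambda>\<omega>. B (T (Suc n) (bm_upto f T B x n \<omega>)) \<omega>) \<in> borel_measurable M"
    by (rule measurable_process_at_random_time[where X = B, rotated 2])
  show ?case
  proof (rule measurable_vec_borelI)
    fix i assume i: "i < Suc n"
    show "(\<lambda>\<omega>. bm_upto f T B x (Suc n) \<omega> ! i) \<in> borel_measurable M"
    proof (cases "i = n")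
      case True
      then show ?thesis
        using last by (simp add: nth_append)
    next
      case False
      with i have "i < n" by simp
      then show ?thesis
        using measurable_compose[OF Suc measurable_nth_vec_borel] by (simp add: nth_append)
    qed
  qed simp
qed

section \<open>The mechanism at the stopping time\<close>

lemma stopping_setE:
  assumes "stopping_function M f T B N" "n \<ge> 1"
  obtains C where "C \<in> sets (vec_borel n)"
    "\<And>x \<omega>. \<omega> \<in> space M \<Longrightarrow> N (bm_path f T B x \<omega>) = n \<longleftrightarrow> bm_upto f T B x n \<omega> \<in> C"
proof -
  have "\<exists>C\<in>sets (vec_borel n). \<forall>x. \<forall>\<omega>\<in>space M.
      N (bm_path f T B x \<omega>) = n \<longleftrightarrow> bm_upto f T B x n \<omega> \<in> C"
    using assms by (simp add: stopping_function_def)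
  then show thesis
    by (elim bexE) (rule that, auto)
qed

lemma measurable_bm_stopped:
  assumes B: "standard_brownian_motion M B" and T: "time_functions T"
    and N: "stopping_function M f T B N"
  shows "bm_stopped f T B N x \<in> M \<rightarrow>\<^sub>M list_borel"
  unfolding bm_stopped_def
proof (rule measurable_compose_countable[where f = "bm_upto f T B x" and g = "\<lambda>\<omega>. N (bm_path f T B x \<omega>)"])
  show "bm_upto f T B x n \<in> M \<rightarrow>\<^sub>M list_borel" for n
    by (rule measurable_vec_borel_list_borel[OF measurable_bm_upto[OF B T]])
  show "(\<lambda>\<omega>. N (bm_path f T B x \<omega>)) \<in> M \<rightarrow>\<^sub>M count_space UNIV"
    unfolding measurable_count_space_eq2_countable
  proof (intro conjI ballI)
    fix n
    show "(\<lambda>\<omega>. N (bm_path f T B x \<omega>)) -` {n} \<inter> space M \<in> sets M"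
    proof (cases "n \<ge> 1")
      case True
      with N obtain C where C: "C \<in> sets (vec_borel n)"
        "\<And>x \<omega>. \<omega> \<in> space M \<Longrightarrow> N (bm_path f T B x \<omega>) = n \<longleftrightarrow> bm_upto f T B x n \<omega> \<in> C"
        by (rule stopping_setE) (rule that)
      have "(\<lambda>\<omega>. N (bm_path f T B x \<omega>)) -` {n} \<inter> space M = bm_upto f T B x n -` C \<inter> space M"
        using C(2) by auto
      then show ?thesis
        using measurable_sets[OF measurable_bm_upto[OF B T] C(1)] by simp
    next
      case False
      \<comment> \<open>Only \<open>n = 0\<close> remains, a value that a stopping function never
        takes.\<close>
      then have "(\<lambda>\<omega>. N (bm_path f T B x \<omega>)) -` {n} = {}"
        using N unfolding stopping_function_def by (auto simp: vimage_def)
      then show ?thesis by simp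
    qed
  qed simp_all
qed

lemma AE_stopped_loss_eq:
  assumes B: "standard_brownian_motion M B" and T: "time_functions T"
    and N: "stopping_function M f T B N" and n: "n \<ge> 1"
  shows "AE \<omega> in M. N (bm_path f T B x \<omega>) = n \<longrightarrow>
           privacy_loss M list_borel (bm_stopped f T B N x) (bm_stopped f T B N x') \<omega>
             = bm_loss M f T B x x' n \<omega>"
proof -
  interpret prob_space M
    using B unfolding standard_brownian_motion_def by blast
  obtain C where C: "C \<in> sets (vec_borel n)"
    and NC: "\<And>y \<omega>. \<omega> \<in> space M \<Longrightarrow> N (bm_path f T B y \<omega>) = n \<longleftrightarrow> bm_upto f T B y n \<omega> \<in> C"
    using N n by (rule stopping_setE) (rule that)
  let ?P = "\<lambda>y. distr M (vec_borel n) (bm_upto f T B y n)"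
  let ?P' = "\<lambda>y. distr M list_borel (bm_stopped f T B N y)"
  note meas = measurable_bm_upto[OF B T] and meas' = measurable_bm_stopped[OF B T N]
  \<comment> \<open>The two events are equal, not merely equally likely. It matters that one
    \<open>C\<close> serves every database \<open>y\<close>: the equality is used for both
    \<open>x\<close> and \<open>x'\<close>.\<close>
  have law_eq: "emeasure (?P y) A = emeasure (?P' y) A" if A: "A \<subseteq> C" "A \<in> sets (vec_borel n)" for y A
  proof -
    have A': "A \<in> sets list_borel" "\<And>\<beta>. \<beta> \<in> A \<Longrightarrow> length \<beta> = n"
      using A(2) by (auto simp: sets_vec_borel_iff)
    have "bm_upto f T B y n \<omega> \<in> A \<longleftrightarrow> bm_stopped f T B N y \<omega> \<in> A" if \<omega>: "\<omega> \<in> space M" for \<omega>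
    proof
      assume "bm_upto f T B y n \<omega> \<in> A"
      moreover from this have "N (bm_path f T B y \<omega>) = n"
        using A(1) NC[OF \<omega>] by blast
      ultimately show "bm_stopped f T B N y \<omega> \<in> A"
        by (simp add: bm_stopped_def)
    next
      assume "bm_stopped f T B N y \<omega> \<in> A"
      \<comment> \<open>The stopped list has length \<open>N\<close>, whereas every list in
        \<open>A\<close> has length \<open>n\<close>.\<close>
      moreover from this have "N (bm_path f T B y \<omega>) = n"
        using A'(2) by (fastforce simp: bm_stopped_def)
      ultimately show "bm_upto f T B y n \<omega> \<in> A"
        by (simp add: bm_stopped_def)
    qed
    then have "bm_upto f T B y n -` A \<inter> space M = bm_stopped f T B N y -` A \<inter> space M"
      by auto
    then show ?thesis
      using A A' by (simp add: emeasure_distr[OF meas] emeasure_distr[OF meas'])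
  qed
  have "AE z in ?P x. z \<in> C \<longrightarrow>
          log_density_ratio (?P x) (?P x') z = log_density_ratio (?P' x) (?P' x') z"
  proof (rule log_density_ratio_eq_on)
    show "A \<in> sets (?P x) \<longleftrightarrow> A \<in> sets (?P' x)" if "A \<subseteq> C" for A
      using that C by (auto simp: sets_vec_borel_iff)
    show "C \<in> sets (?P x)" "C \<in> sets (?P' x)"
      using C by (simp_all add: sets_vec_borel_iff)
    show "emeasure (?P x) A = emeasure (?P' x) A" "emeasure (?P x') A = emeasure (?P' x') A"
      if "A \<subseteq> C" "A \<in> sets (?P x)" for A
      using law_eq[OF that(1)] that(2) by simp_all
  qed (simp_all add: finite_measure_distr meas meas')
  \<comment> \<open>The equality holds almost everywhere under the law of the first \<open>n\<close>
    outputs, so it can be evaluated at these outputs. On \<open>N = n\<close> they are the stopped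
    list.\<close>
  then have "AE \<omega> in M. bm_upto f T B x n \<omega> \<in> C \<longrightarrow>
      log_density_ratio (?P x) (?P x') (bm_upto f T B x n \<omega>)
        = log_density_ratio (?P' x) (?P' x') (bm_upto f T B x n \<omega>)"
    by (rule AE_distrD[OF meas])
  then show ?thesis
    using AE_space
    by eventually_elim (auto dest: NC[THEN iffD1] simp: bm_loss_def privacy_loss_def bm_stopped_def)
qed

section \<open>From the boundary to ex-post privacy\<close>

lemma measurable_boundary_time:
  assumes T: "time_functions T" and \<psi>: "\<psi> \<in> borel_measurable (restrict_space borel {0..})"
    and n: "n \<ge> 1"
  shows "(\<lambda>\<beta>. \<psi> (T n \<beta>)) \<in> borel_measurable (vec_borel (n - 1))"
proof (rule measurable_compose[OF _ \<psi>])
  show "T n \<in> vec_borel (n - 1) \<rightarrow>\<^sub>M restrict_space borel {0..}"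
    using T n unfolding time_functions_def
    by (intro measurable_restrict_space2) (auto intro: less_imp_le)
qed

text \<open>Formulated for subsets \<open>S\<close> of the event that the boundary is reached at the
  stopping time, so that it covers both the event itself and the smaller event of strictly exceeding
  a larger privacy function.\<close>

lemma emeasure_stopped_loss_le:
  assumes B: "standard_brownian_motion M B" and T: "time_functions T"
    and N: "stopping_function M f T B N" and \<psi>: "privacy_boundary M nbr f T B \<delta> \<psi>"
    and nbr: "nbr x x'"
    and S: "S \<subseteq> {\<omega> \<in> space M.
           privacy_loss M list_borel (bm_stopped f T B N x) (bm_stopped f T B N x') \<omega>
             \<ge> ereal (\<psi> (bm_time f T B x (N (bm_path f T B x \<omega>)) \<omega>))}"
  shows "emeasure M S \<le> ennreal \<delta>"
proof -
  interpret prob_space M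
    using B unfolding standard_brownian_motion_def by blast
  let ?E = "{\<omega> \<in> space M. \<exists>n\<ge>1. bm_loss M f T B x x' n \<omega> \<ge> ereal (\<psi> (bm_time f T B x n \<omega>))}"
  have [measurable]: "bm_loss M f T B x x' n \<in> borel_measurable M" for n
    unfolding bm_loss_def by (rule measurable_privacy_loss[OF measurable_bm_upto[OF B T]])
  have "\<psi> \<in> borel_measurable (restrict_space borel {0..})"
    using \<psi> by (simp add: privacy_boundary_def)
  then have [measurable]: "(\<lambda>\<omega>. \<psi> (bm_time f T B x n \<omega>)) \<in> borel_measurable M" if "n \<in> {1..}" for n
    unfolding bm_time_def
    by (rule measurable_compose[OF measurable_bm_upto[OF B T] measurable_boundary_time[OF T]])
      (use that in simp)
  \<comment> \<open>Measurability of \<open>?E\<close> is what the almost sure inclusion of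
    \<open>S\<close> in \<open>?E\<close> requires in order to compare measures.\<close>
  have "?E = (\<Union>n\<in>{1..}. {\<omega> \<in> space M. bm_loss M f T B x x' n \<omega> \<ge> ereal (\<psi> (bm_time f T B x n \<omega>))})"
    by auto
  also have "\<dots> \<in> sets M"
    by (intro sets.countable_UN'') measurable
  finally have E: "?E \<in> sets M" .
  \<comment> \<open>The index is countable, so one null set serves all \<open>n\<close>. Outside it
    \<open>n\<close> may be chosen as the random value of \<open>N\<close>, which is the witness for
    \<open>?E\<close>.\<close>
  have "AE \<omega> in M. \<forall>n. n \<ge> 1 \<longrightarrow> N (bm_path f T B x \<omega>) = n \<longrightarrow>
           privacy_loss M list_borel (bm_stopped f T B N x) (bm_stopped f T B N x') \<omega>
             = bm_loss M f T B x x' n \<omega>"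
    using AE_stopped_loss_eq[OF B T N] by (subst AE_all_countable) auto
  then have "AE \<omega> in M. \<omega> \<in> S \<longrightarrow> \<omega> \<in> ?E"
  proof eventually_elim
    case (elim \<omega>)
    have "N (bm_path f T B x \<omega>) \<ge> 1"
      using N by (simp add: stopping_function_def)
    with elim S show ?case by fastforce
  qed
  then have "emeasure M S \<le> emeasure M ?E"
    using E by (rule emeasure_mono_AE)
  also have "\<dots> \<le> ennreal \<delta>"
    using \<psi> nbr by (auto simp: emeasure_eq_measure privacy_boundary_def intro!: ennreal_leI)
  finally show ?thesis .
qed

text \<open>Common core of both claims: if \<open>\<E>\<close> dominates \<open>\<psi>\<close> along
  the time functions, then a loss above \<open>\<E>\<close> at the stopping time has reached the
  boundary.\<close>

lemma ex_post_private_stopped: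
  assumes B: "standard_brownian_motion M B" and \<delta>: "\<delta> > 0" and T: "time_functions T"
    and N: "stopping_function M f T B N" and \<psi>: "privacy_boundary M nbr f T B \<delta> \<psi>"
    and \<E>: "\<And>n. n \<ge> 1 \<Longrightarrow> \<E> n \<in> borel_measurable (vec_borel (n - 1))"
    and \<psi>_le: "\<And>n \<beta>. n \<ge> 1 \<Longrightarrow> length \<beta> = n - 1 \<Longrightarrow> \<psi> (T n \<beta>) \<le> \<E> n \<beta>"
  shows "ex_post_private M list_borel nbr (bm_stopped f T B N)
           (\<lambda>\<beta>. \<E> (length \<beta>) (butlast \<beta>)) \<delta>"
  unfolding ex_post_private_def
proof (intro conjI allI ballI impI)
  let ?\<E> = "\<lambda>\<beta>. \<E> (length \<beta>) (butlast \<beta>)"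
  have N1: "N \<beta> \<ge> 1" for \<beta>
    using N by (simp add: stopping_function_def)
  \<comment> \<open>Since \<open>N\<close> is a successor, \<open>butlast\<close> of the stopped
    list is the list of the first \<open>N - 1\<close> outputs, the argument of both
    \<open>T\<close> and \<open>\<E>\<close> at index \<open>N\<close>.\<close>
  have bound: "\<psi> (bm_time f T B x (N (bm_path f T B x \<omega>)) \<omega>) \<le> ?\<E> (bm_stopped f T B N x \<omega>)" for x \<omega>
    using \<psi>_le[of "N (bm_path f T B x \<omega>)"] N1[of "bm_path f T B x \<omega>"]
    by (cases "N (bm_path f T B x \<omega>)") (simp_all add: bm_stopped_def bm_time_def)
  show "bm_stopped f T B N x \<in> M \<rightarrow>\<^sub>M list_borel" for x
    by (rule measurable_bm_stopped[OF B T N])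
  show "?\<E> \<in> borel_measurable list_borel"
    using \<E> by (rule measurable_length_butlast)
  \<comment> \<open>Nonnegativity is inherited from \<open>\<psi>\<close> through
    \<open>bound\<close>.\<close>
  show "0 \<le> ?\<E> (bm_stopped f T B N x \<omega>)" for x \<omega>
  proof -
    have "0 \<le> bm_time f T B x (N (bm_path f T B x \<omega>)) \<omega>"
      using T N1 unfolding bm_time_def time_functions_def by (intro less_imp_le) simp
    then have "0 \<le> \<psi> (bm_time f T B x (N (bm_path f T B x \<omega>)) \<omega>)"
      using \<psi> by (simp add: privacy_boundary_def)
    also note bound
    finally show ?thesis .
  qed
  fix x x' assume nbr: "nbr x x'"
  let ?A = "{\<omega> \<in> space M.
      privacy_loss M list_borel (bm_stopped f T B N x) (bm_stopped f T B N x') \<omega>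
        > ereal (?\<E> (bm_stopped f T B N x \<omega>))}"
  have "emeasure M ?A \<le> ennreal \<delta>"
  proof (rule emeasure_stopped_loss_le[OF B T N \<psi> nbr], safe)
    fix \<omega> assume "ereal (?\<E> (bm_stopped f T B N x \<omega>))
      < privacy_loss M list_borel (bm_stopped f T B N x) (bm_stopped f T B N x') \<omega>"
    then show "ereal (\<psi> (bm_time f T B x (N (bm_path f T B x \<omega>)) \<omega>))
      \<le> privacy_loss M list_borel (bm_stopped f T B N x) (bm_stopped f T B N x') \<omega>"
      using bound[of x \<omega>] by (meson ereal_less_eq(3) less_imp_le order_trans)
  qed
  then show "measure M ?A \<le> \<delta>"
    unfolding measure_def using \<delta> by (intro enn2real_leI) auto
qed

text \<open>The infimum of the level set is attained. Otherwise \<open>\<psi>\<close> exceeds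
  \<open>e\<close> at \<open>t\<close> and, by semicontinuity, on an interval to its right, so the
  level set stays above some \<open>b > t\<close>. The infimum is taken in \<open>ereal\<close>,
  where an empty level set would give \<infinity> instead of the real \<open>t\<close>.\<close>

lemma Inf_level_mem:
  fixes \<psi> :: "real \<Rightarrow> real"
  assumes lsc: "right_lower_semicontinuous \<psi>" and "t > 0"
    and t: "ereal t = (INF s \<in> {s. 0 \<le> s \<and> \<psi> s \<le> e}. ereal s)"
  shows "\<psi> t \<le> e"
proof (rule ccontr)
  assume "\<not> \<psi> t \<le> e"
  then have e: "e < \<psi> t"
    by simp
  with lsc \<open>t > 0\<close> have "eventually (\<lambda>s. e < \<psi> s) (at_right t)"
    unfolding right_lower_semicontinuous_def by blast
  then obtain b where b: "b > t" "\<And>s. t < s \<Longrightarrow> s < b \<Longrightarrow> e < \<psi> s"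
    unfolding eventually_at_right_field by blast
  have "ereal b \<le> (INF s \<in> {s. 0 \<le> s \<and> \<psi> s \<le> e}. ereal s)"
  proof (rule INF_greatest, clarify)
    fix s assume s: "0 \<le> s" "\<psi> s \<le> e"
    then have "ereal t \<le> ereal s"
      unfolding t by (intro INF_lower) simp
    \<comment> \<open>The point \<open>s\<close> is at least the infimum \<open>t\<close>, and
      differs from it because \<open>\<psi> s \<le> e < \<psi> t\<close>.\<close>
    with s e have "t < s"
      by (cases "s = t") auto
    with b(2)[of s] s(2) show "ereal b \<le> ereal s"
      by force
  qed
  with b(1) show False
    by (simp flip: t)
qed

theorem corollary3p7:
  fixes M :: "'w measure"
    and B :: "real \<Rightarrow> 'w \<Rightarrow> real ^ 'd"
    and nbr :: "'x \<Rightarrow> 'x \<Rightarrow> bool"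
    and f :: "'x \<Rightarrow> real ^ 'd"
    and \<delta> :: real
  assumes "standard_brownian_motion M B"
    and "\<delta> > 0"
  shows
    "(\<forall>T N \<psi>.
        time_functions T \<longrightarrow> stopping_function M f T B N \<longrightarrow> privacy_boundary M nbr f T B \<delta> \<psi> \<longrightarrow>
        (SUP (x, x') \<in> {(x, x'). nbr x x'}.
           emeasure M {\<omega> \<in> space M.
             privacy_loss M list_borel (bm_stopped f T B N x) (bm_stopped f T B N x') \<omega>
               \<ge> ereal (\<psi> (bm_time f T B x (N (bm_path f T B x \<omega>)) \<omega>))}) \<le> ennreal \<delta> \<and>
        ex_post_private M list_borel nbr (bm_stopped f T B N)
          (\<lambda>\<beta>. \<psi> (T (length \<beta>) (butlast \<beta>))) \<delta>) \<and>
     (\<forall>\<E> \<psi> T N.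
        privacy_functions \<E> \<longrightarrow>
        right_lower_semicontinuous \<psi> \<longrightarrow>
        (\<forall>n\<ge>1. \<forall>\<beta>. length \<beta> = n - 1 \<longrightarrow>
           ereal (T n \<beta>) = (INF t \<in> {t. 0 \<le> t \<and> \<psi> t \<le> \<E> n \<beta>}. ereal t)) \<longrightarrow>
        time_functions T \<longrightarrow> privacy_boundary M nbr f T B \<delta> \<psi> \<longrightarrow> stopping_function M f T B N \<longrightarrow>
        ex_post_private M list_borel nbr (bm_stopped f T B N)
          (\<lambda>\<beta>. \<E> (length \<beta>) (butlast \<beta>)) \<delta>)"
proof (intro conjI allI impI)
  fix T N \<psi>
  assume T: "time_functions T" and N: "stopping_function M f T B N"
    and \<psi>: "privacy_boundary M nbr f T B \<delta> \<psi>"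
  show "(SUP (x, x') \<in> {(x, x'). nbr x x'}.
           emeasure M {\<omega> \<in> space M.
             privacy_loss M list_borel (bm_stopped f T B N x) (bm_stopped f T B N x') \<omega>
               \<ge> ereal (\<psi> (bm_time f T B x (N (bm_path f T B x \<omega>)) \<omega>))}) \<le> ennreal \<delta>"
    \<comment> \<open>Here \<open>S\<close> is the full event.\<close>
    by (rule SUP_least, clarify) (rule emeasure_stopped_loss_le[OF assms(1) T N \<psi> _ order_refl])
  show "ex_post_private M list_borel nbr (bm_stopped f T B N)
          (\<lambda>\<beta>. \<psi> (T (length \<beta>) (butlast \<beta>))) \<delta>"
    using \<psi>
    \<comment> \<open>The privacy function is the boundary along the time functions, so domination
      holds with equality.\<close>
    by (intro ex_post_private_stopped[OF assms T N \<psi>, of "\<lambda>n \<beta>. \<psi> (T n \<beta>)"]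
        measurable_boundary_time[OF T]) (auto simp: privacy_boundary_def)
next
  fix \<E> :: "nat \<Rightarrow> (real ^ 'd) list \<Rightarrow> real" and \<psi> T N
  assume \<E>: "privacy_functions \<E>" and lsc: "right_lower_semicontinuous \<psi>"
    and inf: "\<forall>n\<ge>1. \<forall>\<beta>. length \<beta> = n - 1 \<longrightarrow>
           ereal (T n \<beta>) = (INF t \<in> {t. 0 \<le> t \<and> \<psi> t \<le> \<E> n \<beta>}. ereal t)"
    and T: "time_functions T" and \<psi>: "privacy_boundary M nbr f T B \<delta> \<psi>"
    and N: "stopping_function M f T B N"
  show "ex_post_private M list_borel nbr (bm_stopped f T B N)
          (\<lambda>\<beta>. \<E> (length \<beta>) (butlast \<beta>)) \<delta>"
  proof (rule ex_post_private_stopped[OF assms T N \<psi>])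
    show "\<E> n \<in> borel_measurable (vec_borel (n - 1))" if "n \<ge> 1" for n
      using \<E> that by (simp add: privacy_functions_def)
    show "\<psi> (T n \<beta>) \<le> \<E> n \<beta>" if "n \<ge> 1" "length \<beta> = n - 1" for n \<beta>
      \<comment> \<open>Positivity of time functions places \<open>T n \<beta>\<close> in the range
        where semicontinuity is assumed.\<close>
      using T inf that by (intro Inf_level_mem[OF lsc]) (auto simp: time_functions_def)
  qed
qed

end
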